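(* Let $u:[a,b]\to\mathbb{R}$ be monotonic nondecreasing on $[a,b]$ and let $f:[a,b]\to\mathbb{R}$ be of bounded variation such that the Riemann–Stieltjes integral $\int_a^b f(x)\,du(x)$ exists. Then $$|D(f;u)|\le\left[u(b)-u(a)-Q(u)\right]\bigvee_a^b(f)\le\left[u(b)-u(a)\right]\bigvee_a^b(f),$$ where $$Q(u):=\frac{1}{b-a}\int_a^b\operatorname{sgn}\left(x-\frac{a+b}{2}\right)u(x)\,dx=\frac{1}{b-a}\int_a^b\operatorname{sgn}\left(x-\frac{a+b}{2}\right)\left[u(x)-u\left(\frac{a+b}{2}\right)\right]dx\ge 0.$$ The first inequality is sharp in the sense that the constant $c=1$ in $|D(f;u)|\le c\,[u(b)-u(a)-Q(u)]\bigvee_a^b(f)$ cannot be replaced by a smaller constant.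
   Context: $D(f;u):=\int_a^b f(x)\,du(x)-[u(b)-u(a)]\cdot\frac{1}{b-a}\int_a^b f(t)\,dt$, where the first integral is a Riemann–Stieltjes integral. $\bigvee_a^b(f)$ denotes the total variation of $f$ on $[a,b]$, and $\operatorname{sgn}$ is the sign function. *)

theory Defs
  imports "HOL-Analysis.Analysis"
begin

text \<open>
  Functions on the interval from a to b are represented by total functions of type
  \<^typ>\<open>real \<Rightarrow> real\<close>; only their values on \<open>{a..b}\<close> enter the notions below.
  A member K of a division of \<open>{a..b}\<close> is a compact interval, with endpoints
  \<open>Inf K\<close> and \<open>Sup K\<close>. Degenerate intervals (a single point), which the library
  admits in divisions, contribute 0 to all the sums below.
\<close>

definition has_bounded_variation :: "(real \<Rightarrow> real) \<Rightarrow> real \<Rightarrow> real \<Rightarrow> bool" where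
  "has_bounded_variation f a b \<longleftrightarrow>
     bdd_above {\<Sum>K\<in>d. \<bar>f (Sup K) - f (Inf K)\<bar> | d. d division_of {a..b}}"

definition total_variation :: "(real \<Rightarrow> real) \<Rightarrow> real \<Rightarrow> real \<Rightarrow> real" where
  "total_variation f a b =
     Sup {\<Sum>K\<in>d. \<bar>f (Sup K) - f (Inf K)\<bar> | d. d division_of {a..b}}"

text \<open>
  The Riemann--Stieltjes integral is the limit of the tagged sums as the mesh of the
  partition tends to 0 (as opposed to the limit along refinement of partitions).
\<close>

definition has_rs_integral ::
    "(real \<Rightarrow> real) \<Rightarrow> (real \<Rightarrow> real) \<Rightarrow> real \<Rightarrow> real \<Rightarrow> real \<Rightarrow> bool" where
  "has_rs_integral f u a b I \<longleftrightarrow>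
     (\<forall>e>0. \<exists>\<delta>>0. \<forall>p. p tagged_division_of {a..b} \<and> (\<forall>(x, K)\<in>p. Sup K - Inf K < \<delta>) \<longrightarrow>
        \<bar>(\<Sum>(x, K)\<in>p. f x * (u (Sup K) - u (Inf K))) - I\<bar> < e)"

definition rs_integrable :: "(real \<Rightarrow> real) \<Rightarrow> (real \<Rightarrow> real) \<Rightarrow> real \<Rightarrow> real \<Rightarrow> bool" where
  "rs_integrable f u a b \<longleftrightarrow> (\<exists>I. has_rs_integral f u a b I)"

definition rs_integral :: "(real \<Rightarrow> real) \<Rightarrow> (real \<Rightarrow> real) \<Rightarrow> real \<Rightarrow> real \<Rightarrow> real" where
  "rs_integral f u a b = (THE I. has_rs_integral f u a b I)"

definition D_functional :: "(real \<Rightarrow> real) \<Rightarrow> (real \<Rightarrow> real) \<Rightarrow> real \<Rightarrow> real \<Rightarrow> real" where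
  "D_functional f u a b =
     rs_integral f u a b - (u b - u a) * (1 / (b - a) * integral {a..b} f)"

definition Q_functional :: "(real \<Rightarrow> real) \<Rightarrow> real \<Rightarrow> real \<Rightarrow> real" where
  "Q_functional u a b =
     1 / (b - a) * integral {a..b} (\<lambda>x. sgn (x - (a + b) / 2) * u x)"

end

theory Submission
  imports Defs
begin

text \<open>
  Write \<open>m = (a + b) / 2\<close>, \<open>V\<close> for the total variation of \<open>f\<close>, \<open>\<Delta> = u b - u a\<close>, and \<open>M\<close> for the
  mean value of \<open>f\<close>. Then \<open>D(f;u)\<close> is the Riemann--Stieltjes integral of \<open>f - M\<close> against \<open>u\<close>, and
  two facts bound it.

  First, a function of bounded variation satisfies the Ostrowski inequality
  \<open>\<bar>f x - M\<bar> \<le> (1/2 + \<bar>x - m\<bar> / (b - a)) * V\<close> (\<open>ostrowski_bounded_variation\<close>): the oscillation of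
  \<open>f\<close> about \<open>f x\<close> to the left of \<open>x\<close> and the one to the right of \<open>x\<close> add up to at most \<open>V\<close>, and they
  are weighted by \<open>x - a\<close> and \<open>b - x\<close>, which are at most \<open>(b - a)/2 + \<bar>x - m\<bar>\<close>.

  Second, integration by parts turns the integral of \<open>\<bar>x - m\<bar>\<close> against \<open>u\<close> into
  \<open>(b - a) * (\<Delta>/2 - Q(u))\<close>, because the derivative of \<open>\<bar>x - m\<bar>\<close> is \<open>sgn (x - m)\<close>. Since \<open>u\<close> is
  nondecreasing, integrating the Ostrowski bound against \<open>u\<close> yields
  \<open>\<bar>D(f;u)\<bar> \<le> (\<Delta>/2 + \<Delta>/2 - Q(u)) * V\<close>. The argument runs on
  tagged sums, where integration by parts becomes a telescoping sum with an error controlled by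
  the mesh (\<open>rs_sum_dist_midpoint_le\<close>).

  The number \<open>Q(u)\<close> does not change when a constant is subtracted from \<open>u\<close>, since \<open>sgn (x - m)\<close>
  has integral zero; subtracting \<open>u m\<close> makes the integrand nonnegative, so \<open>Q(u) \<ge> 0\<close>.

  For sharpness let \<open>u\<close> jump from 0 to 1 at \<open>b\<close> and \<open>f\<close> jump from 0 to 1 at \<open>t < b\<close>. Then
  \<open>Q(u) = 0\<close>, \<open>\<Delta> = V = 1\<close> and \<open>D(f;u) = 1 - (b - t)/(b - a)\<close>, which tends to 1 as \<open>t\<close> tends to \<open>b\<close>.
\<close>

section \<open>Divisions of an interval\<close>

lemma division_of_realE:
  fixes a b :: real
  assumes "d division_of {a..b}" "K \<in> d"
  obtains c e where "K = {c..e}" "c \<le> e" "a \<le> c" "e \<le> b"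
proof -
  obtain c e where ce: "K = cbox c e" "K \<noteq> {}" "K \<subseteq> {a..b}"
    by (rule cbox_division_memE[OF assms(2,1)])
  then have "c \<le> e" by auto
  moreover have "a \<le> c" "e \<le> b" using ce by auto
  ultimately show ?thesis using ce that by auto
qed

lemma tagged_division_of_realE:
  fixes a b :: real
  assumes "p tagged_division_of {a..b}" "(x, K) \<in> p"
  obtains c e where "K = {c..e}" "c \<le> x" "x \<le> e" "a \<le> c" "e \<le> b"
proof -
  have "snd ` p division_of {a..b}" using assms(1) by (rule division_of_tagged_division)
  moreover have "K \<in> snd ` p" using assms(2) by force
  ultimately obtain c e where ce: "K = {c..e}" "a \<le> c" "e \<le> b" by (rule division_of_realE)
  moreover have "x \<in> K" using assms by blast
  ultimately show ?thesis using that by auto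
qed

lemma telescope_division:
  fixes h :: "real \<Rightarrow> real"
  assumes "a \<le> b" and d: "d division_of {a..b}"
  shows "(\<Sum>K\<in>d. h (Sup K) - h (Inf K)) = h b - h a"
proof -
  let ?t = "\<lambda>K::real set. (Inf K, K)"
  have tag: "?t ` d tagged_division_of {a..b}"
  proof (rule tagged_division_ofI)
    show "finite (?t ` d)" using d by blast
    show "x \<in> K" if "(x, K) \<in> ?t ` d" for x K
    proof -
      from that have "K \<in> d" "x = Inf K" by auto
      obtain c e where "K = {c..e}" "c \<le> e" by (rule division_of_realE[OF d \<open>K \<in> d\<close>])
      then show ?thesis using \<open>x = Inf K\<close> by simp
    qed
    show "K \<subseteq> {a..b}" if "(x, K) \<in> ?t ` d" for x K using that d by blast
    show "\<exists>a b. K = cbox a b" if "(x, K) \<in> ?t ` d" for x K using that d by blast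
    show "interior K1 \<inter> interior K2 = {}"
      if "(x1, K1) \<in> ?t ` d" "(x2, K2) \<in> ?t ` d" "(x1, K1) \<noteq> (x2, K2)" for x1 K1 x2 K2
    proof -
      from that have "K1 \<in> d" "K2 \<in> d" "K1 \<noteq> K2" by auto
      then show ?thesis by (rule division_ofD(5)[OF d])
    qed
    have "{K. \<exists>x. (x, K) \<in> ?t ` d} = d" by auto
    then show "\<Union>{K. \<exists>x. (x, K) \<in> ?t ` d} = {a..b}" using d by auto
  qed
  have "(\<Sum>(x, K)\<in>?t ` d. h (Sup K) - h (Inf K)) = (\<Sum>K\<in>d. h (Sup K) - h (Inf K))"
    by (subst sum.reindex) (auto simp: inj_on_def)
  then show ?thesis using additive_tagged_division_1[OF \<open>a \<le> b\<close> tag, of h] by simp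
qed

lemma tagged_division_mesh_exists:
  fixes a b :: real
  assumes "\<delta> > 0"
  obtains p where "p tagged_division_of {a..b}" "\<forall>(x, K)\<in>p. Sup K - Inf K < \<delta>"
proof -
  have "gauge (\<lambda>x::real. ball x (\<delta>/2))" using assms by (intro gauge_ball) auto
  then obtain p where p: "p tagged_division_of {a..b}" "(\<lambda>x. ball x (\<delta>/2)) fine p"
    by (rule fine_division_exists_real)
  have "Sup K - Inf K < \<delta>" if xK: "(x, K) \<in> p" for x K
  proof -
    obtain c e where ce: "K = {c..e}" "c \<le> x" "x \<le> e"
      by (rule tagged_division_of_realE[OF p(1) xK])
    have "K \<subseteq> ball x (\<delta>/2)" using p(2) xK by (auto simp: fine_def)
    moreover have "c \<in> K" "e \<in> K" using ce by auto
    ultimately have "dist x c < \<delta>/2" "dist x e < \<delta>/2" by (auto simp: subset_iff)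
    then show ?thesis using ce by (auto simp: dist_real_def)
  qed
  then show ?thesis using that p(1) by blast
qed

section \<open>Functions of bounded variation\<close>

lemma sum_le_total_variation:
  assumes "has_bounded_variation f a b" "d division_of {a..b}"
  shows "(\<Sum>K\<in>d. \<bar>f (Sup K) - f (Inf K)\<bar>) \<le> total_variation f a b"
  unfolding total_variation_def
  by (rule cSup_upper) (use assms in \<open>auto simp: has_bounded_variation_def\<close>)

lemma total_variation_least:
  assumes "a \<le> b"
    and "\<And>d. d division_of {a..b} \<Longrightarrow> (\<Sum>K\<in>d. \<bar>f (Sup K) - f (Inf K)\<bar>) \<le> B"
  shows "total_variation f a b \<le> B"
  unfolding total_variation_def
proof (rule cSup_least)
  have "{{a..b}} division_of {a..b}"
    using division_of_self[of a b] assms(1) by simp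
  then show "{\<Sum>K\<in>d. \<bar>f (Sup K) - f (Inf K)\<bar> | d. d division_of {a..b}} \<noteq> {}" by blast
qed (use assms(2) in auto)

lemma total_variation_nonneg:
  assumes "a \<le> b" "has_bounded_variation f a b"
  shows "0 \<le> total_variation f a b"
proof -
  have "{{a..b}} division_of {a..b}" using division_of_self[of a b] assms(1) by simp
  from sum_le_total_variation[OF assms(2) this] show ?thesis
    using abs_ge_zero[of "f b - f a"] assms(1) by simp
qed

text \<open>
  A division of \<open>{a..x}\<close> is prolonged by the single interval \<open>{x..y}\<close>. This one step yields both the
  bounded variation on subintervals and the growth of the variation function.
\<close>

lemma variation_sum_extend:
  fixes f :: "real \<Rightarrow> real"
  assumes "a \<le> x" "x < y" and d: "d division_of {a..x}"
  shows "insert {x..y} d division_of {a..y}"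
    and "(\<Sum>K\<in>insert {x..y} d. \<bar>f (Sup K) - f (Inf K)\<bar>)
         = (\<Sum>K\<in>d. \<bar>f (Sup K) - f (Inf K)\<bar>) + \<bar>f y - f x\<bar>"
proof -
  have "{{x..y}} division_of {x..y}" using division_of_self[of x y] assms by simp
  moreover have "interior {a..x} \<inter> interior {x..y} = {}" by auto
  ultimately have "d \<union> {{x..y}} division_of {a..x} \<union> {x..y}"
    by (intro division_disjoint_union[OF d])
  moreover have "{a..x} \<union> {x..y} = {a..y}" using assms by auto
  ultimately show "insert {x..y} d division_of {a..y}" by simp
  have "{x..y} \<notin> d"
  proof
    assume "{x..y} \<in> d"
    then have "{x..y} \<subseteq> {a..x}" by (rule division_ofD(2)[OF d])
    then show False using assms by auto
  qed
  then show "(\<Sum>K\<in>insert {x..y} d. \<bar>f (Sup K) - f (Inf K)\<bar>)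
         = (\<Sum>K\<in>d. \<bar>f (Sup K) - f (Inf K)\<bar>) + \<bar>f y - f x\<bar>"
    using division_of_finite[OF d] assms by (subst sum.insert) auto
qed

lemma has_bounded_variation_initial:
  assumes "a \<le> x" "x \<le> b" and bv: "has_bounded_variation f a b"
  shows "has_bounded_variation f a x"
proof (cases "x = b")
  case False
  with assms have "x < b" by simp
  have "(\<Sum>K\<in>d. \<bar>f (Sup K) - f (Inf K)\<bar>) \<le> total_variation f a b"
    if "d division_of {a..x}" for d
    using sum_le_total_variation[OF bv variation_sum_extend(1)[OF \<open>a \<le> x\<close> \<open>x < b\<close> that]]
      variation_sum_extend(2)[OF \<open>a \<le> x\<close> \<open>x < b\<close> that, of f] abs_ge_zero[of "f b - f x"]
    by linarith
  then show ?thesis unfolding has_bounded_variation_def by (auto intro!: bdd_aboveI)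
qed (use bv in simp)

lemma total_variation_increment:
  assumes "a \<le> x" "x \<le> y" "y \<le> b" and bv: "has_bounded_variation f a b"
  shows "\<bar>f y - f x\<bar> \<le> total_variation f a y - total_variation f a x"
proof (cases "x = y")
  case False
  with assms have "x < y" by simp
  have bvy: "has_bounded_variation f a y" using assms by (intro has_bounded_variation_initial[OF _ _ bv]) auto
  have "total_variation f a x \<le> total_variation f a y - \<bar>f y - f x\<bar>"
  proof (rule total_variation_least[OF \<open>a \<le> x\<close>])
    fix d assume d: "d division_of {a..x}"
    show "(\<Sum>K\<in>d. \<bar>f (Sup K) - f (Inf K)\<bar>) \<le> total_variation f a y - \<bar>f y - f x\<bar>"
      using sum_le_total_variation[OF bvy variation_sum_extend(1)[OF \<open>a \<le> x\<close> \<open>x < y\<close> d]]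
        variation_sum_extend(2)[OF \<open>a \<le> x\<close> \<open>x < y\<close> d, of f]
      by linarith
  qed
  then show ?thesis by simp
qed simp

text \<open>
  Jordan decomposition: both the variation function and its difference with \<open>f\<close> are nondecreasing.
\<close>

lemma integrable_bounded_variation:
  assumes bv: "has_bounded_variation f a b"
  shows "f integrable_on {a..b}"
proof -
  let ?v = "total_variation f a"
  have "mono_on {a..b} ?v" "mono_on {a..b} (\<lambda>x. ?v x - f x)"
    using total_variation_increment[OF _ _ _ bv] by (intro mono_onI; force simp: abs_le_iff)+
  then have "?v integrable_on {a..b}" "(\<lambda>x. ?v x - f x) integrable_on {a..b}"
    by (auto intro: integrable_on_mono_on)
  from integrable_diff[OF this] show ?thesis by simp
qed

text \<open>
  Split the integral of \<open>f x - f t\<close> over \<open>t\<close> at the point \<open>x\<close> and bound the two parts by the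
  variation of \<open>f\<close> to the left and to the right of \<open>x\<close>.
\<close>

lemma ostrowski_bounded_variation:
  fixes f :: "real \<Rightarrow> real"
  assumes "a < b" and x: "x \<in> {a..b}" and bv: "has_bounded_variation f a b"
  shows "\<bar>f x - 1 / (b - a) * integral {a..b} f\<bar>
         \<le> (1/2 + \<bar>x - (a + b)/2\<bar> / (b - a)) * total_variation f a b"
proof -
  let ?v = "total_variation f a"
  have ax: "a \<le> x" and xb: "x \<le> b" using x by auto
  let ?g = "\<lambda>t. f x - f t"
  have fi: "f integrable_on {a..b}" by (rule integrable_bounded_variation[OF bv])
  have gi: "?g integrable_on {a..b}" by (intro integrable_diff integrable_const_ivl fi)
  have g1: "?g integrable_on {a..x}" and g2: "?g integrable_on {x..b}"
    using gi ax xb by (auto elim!: integrable_on_subinterval)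
  have "norm (integral {a..x} ?g) \<le> integral {a..x} (\<lambda>_. ?v x - ?v a)"
  proof (rule integral_norm_bound_integral[OF g1])
    fix t assume "t \<in> {a..x}"
    then show "norm (?g t) \<le> ?v x - ?v a"
      using total_variation_increment[OF _ _ xb bv, of t]
        total_variation_increment[OF order_refl _ _ bv, of t] xb by auto
  qed auto
  then have I1: "\<bar>integral {a..x} ?g\<bar> \<le> (x - a) * (?v x - ?v a)" using ax by simp
  have "norm (integral {x..b} ?g) \<le> integral {x..b} (\<lambda>_. ?v b - ?v x)"
  proof (rule integral_norm_bound_integral[OF g2])
    fix t assume "t \<in> {x..b}"
    then show "norm (?g t) \<le> ?v b - ?v x"
      using total_variation_increment[OF ax _ _ bv, of t]
        total_variation_increment[OF _ _ order_refl bv, of t] ax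
      by (auto simp: abs_minus_commute)
  qed auto
  then have I2: "\<bar>integral {x..b} ?g\<bar> \<le> (b - x) * (?v b - ?v x)" using xb by simp
  let ?w = "(b - a)/2 + \<bar>x - (a + b)/2\<bar>"
  have "?v a \<le> ?v x" "?v x \<le> ?v b"
    using total_variation_increment[OF order_refl ax xb bv]
      total_variation_increment[OF ax xb order_refl bv] by linarith+
  moreover have "x - a \<le> ?w" "b - x \<le> ?w" by (auto simp: abs_if field_simps)
  ultimately have "(x - a) * (?v x - ?v a) \<le> ?w * (?v x - ?v a)"
    "(b - x) * (?v b - ?v x) \<le> ?w * (?v b - ?v x)"
    by (intro mult_right_mono; simp)+
  then have "(x - a) * (?v x - ?v a) + (b - x) * (?v b - ?v x) \<le> ?w * (?v b - ?v a)"
    by (simp add: algebra_simps)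
  also have "\<dots> \<le> ?w * ?v b"
  proof (rule mult_left_mono)
    have "has_bounded_variation f a a"
      using has_bounded_variation_initial[OF order_refl _ bv] \<open>a < b\<close> by simp
    then show "?v b - ?v a \<le> ?v b" using total_variation_nonneg[of a a f] by simp
  qed (use \<open>a < b\<close> in simp)
  finally have "(x - a) * (?v x - ?v a) + (b - x) * (?v b - ?v x) \<le> ?w * ?v b" .
  moreover have "integral {a..x} ?g + integral {x..b} ?g = integral {a..b} ?g"
    by (rule Henstock_Kurzweil_Integration.integral_combine[OF ax xb gi])
  ultimately have main: "\<bar>integral {a..b} ?g\<bar> \<le> ?w * ?v b" using I1 I2 by linarith
  have "integral {a..b} ?g = (b - a) * f x - integral {a..b} f"
    using \<open>a < b\<close> fi by (subst Henstock_Kurzweil_Integration.integral_diff) auto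
  then have "f x - 1 / (b - a) * integral {a..b} f = integral {a..b} ?g / (b - a)"
    using \<open>a < b\<close> by (simp add: field_simps)
  then have "\<bar>f x - 1 / (b - a) * integral {a..b} f\<bar> = \<bar>integral {a..b} ?g\<bar> / (b - a)"
    using \<open>a < b\<close> by simp
  also have "\<dots> \<le> ?w * ?v b / (b - a)" using main \<open>a < b\<close> by (intro divide_right_mono) auto
  also have "\<dots> = (1/2 + \<bar>x - (a + b)/2\<bar> / (b - a)) * ?v b"
    using \<open>a < b\<close> by (simp add: field_simps)
  finally show ?thesis .
qed

section \<open>Integrals against the sign function\<close>

lemma has_integral_sgn:
  fixes c e m :: real
  assumes "c \<le> e"
  shows "((\<lambda>x. sgn (x - m)) has_integral (\<bar>e - m\<bar> - \<bar>c - m\<bar>)) {c..e}"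
proof (rule fundamental_theorem_of_calculus_strong[where S = "{m}"])
  fix x assume "x \<in> {c..e} - {m}"
  then consider "x < m" | "m < x" by fastforce
  then show "((\<lambda>x. \<bar>x - m\<bar>) has_vector_derivative sgn (x - m)) (at x)"
  proof cases
    case 1
    have "((\<lambda>x. m - x) has_vector_derivative -1) (at x)"
      by (auto intro!: derivative_eq_intros)
    then have "((\<lambda>x. \<bar>x - m\<bar>) has_vector_derivative -1) (at x)"
      by (rule has_vector_derivative_transform_within_open[where S = "{..<m}"]) (use 1 in auto)
    then show ?thesis using 1 by simp
  next
    case 2
    have "((\<lambda>x. x - m) has_vector_derivative 1) (at x)"
      by (auto intro!: derivative_eq_intros)
    then have "((\<lambda>x. \<bar>x - m\<bar>) has_vector_derivative 1) (at x)"
      by (rule has_vector_derivative_transform_within_open[where S = "{m<..}"]) (use 2 in auto)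
    then show ?thesis using 2 by simp
  qed
qed (use assms in \<open>auto intro!: continuous_intros\<close>)

text \<open>
  For nondecreasing \<open>u\<close> the product \<open>sgn (x - m) * (u x - u m)\<close> equals \<open>\<bar>u x - u m\<bar>\<close>, a difference of
  two nondecreasing functions.
\<close>

lemma sgn_mult_mono_on:
  fixes u :: "real \<Rightarrow> real"
  assumes "mono_on {a..b} u" "m \<in> {a..b}" "x \<in> {a..b}"
  shows "sgn (x - m) * (u x - u m) = max (u x - u m) 0 - min (u x - u m) 0"
proof (cases x m rule: linorder_cases)
  case less
  then have "u x \<le> u m" using assms by (auto intro: mono_onD)
  then show ?thesis using less by simp
next
  case greater
  then have "u m \<le> u x" using assms by (auto intro: mono_onD)
  then show ?thesis using greater by simp
qed simp

lemma integrable_sgn_mult_diff: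
  fixes u :: "real \<Rightarrow> real"
  assumes u: "mono_on {a..b} u" and m: "m \<in> {a..b}"
  shows "(\<lambda>x. sgn (x - m) * (u x - u m)) integrable_on {a..b}"
proof (rule integrable_eq)
  have "max (u x - u m) 0 \<le> max (u y - u m) 0" "min (u x - u m) 0 \<le> min (u y - u m) 0"
    if "x \<in> {a..b}" "y \<in> {a..b}" "x \<le> y" for x y
    using mono_onD[OF u that] by linarith+
  then have "mono_on {a..b} (\<lambda>x. max (u x - u m) 0)" "mono_on {a..b} (\<lambda>x. min (u x - u m) 0)"
    by (auto intro!: mono_onI)
  then show "(\<lambda>x. max (u x - u m) 0 - min (u x - u m) 0) integrable_on {a..b}"
    by (intro integrable_diff integrable_on_mono_on)
qed (use sgn_mult_mono_on[OF u m] in simp)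

lemma integrable_sgn_mult:
  fixes u :: "real \<Rightarrow> real"
  assumes u: "mono_on {a..b} u" and m: "m \<in> {a..b}"
  shows "(\<lambda>x. sgn (x - m) * u x) integrable_on {a..b}"
proof -
  have "(\<lambda>x. sgn (x - m)) integrable_on {a..b}"
    using has_integral_sgn[of a b m] m by (auto simp: integrable_on_def)
  then have "(\<lambda>x. sgn (x - m) * (u x - u m) + sgn (x - m) * u m) integrable_on {a..b}"
    by (intro integrable_add integrable_sgn_mult_diff[OF u m] integrable_on_mult_left)
  then show ?thesis by (simp add: algebra_simps)
qed

lemma Q_functional_eq:
  fixes u :: "real \<Rightarrow> real"
  assumes "a < b" and u: "mono_on {a..b} u"
  shows "Q_functional u a b =
         1 / (b - a) * integral {a..b} (\<lambda>x. sgn (x - (a + b)/2) * (u x - u ((a + b)/2)))"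
proof -
  let ?m = "(a + b)/2"
  have m: "?m \<in> {a..b}" using \<open>a < b\<close> by simp
  have "((\<lambda>x. sgn (x - ?m)) has_integral 0) {a..b}"
    using has_integral_sgn[of a b ?m] \<open>a < b\<close> by (simp add: abs_if field_simps)
  then have "((\<lambda>x. sgn (x - ?m) * u ?m) has_integral 0) {a..b}"
    by (auto dest: has_integral_mult_left)
  from has_integral_diff[OF integrable_integral[OF integrable_sgn_mult[OF u m]] this]
  have "integral {a..b} (\<lambda>x. sgn (x - ?m) * (u x - u ?m)) = integral {a..b} (\<lambda>x. sgn (x - ?m) * u x)"
    by (simp add: right_diff_distrib integral_unique)
  then show ?thesis by (simp add: Q_functional_def)
qed

lemma Q_functional_nonneg:
  fixes u :: "real \<Rightarrow> real"
  assumes "a < b" and u: "mono_on {a..b} u"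
  shows "0 \<le> Q_functional u a b"
proof -
  have m: "(a + b)/2 \<in> {a..b}" using \<open>a < b\<close> by simp
  have "0 \<le> integral {a..b} (\<lambda>x. sgn (x - (a + b)/2) * (u x - u ((a + b)/2)))"
    by (rule integral_nonneg[OF integrable_sgn_mult_diff[OF u m]])
      (simp add: sgn_mult_mono_on[OF u m])
  then show ?thesis using \<open>a < b\<close> by (simp add: Q_functional_eq[OF assms])
qed

section \<open>Riemann--Stieltjes sums\<close>

text \<open>
  Integration by parts on one interval, up to an error of the order of its length: the first three
  terms on the right are the increment of a primitive, so they telescope over a division. Replacing
  \<open>u\<close> by \<open>u - u c\<close> changes neither side and makes the remaining integral at most
  \<open>(e - c) * (u e - u c)\<close>; moving the tag \<open>x\<close> to \<open>e\<close> costs at most the same amount.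
\<close>

lemma dist_increment_by_parts:
  fixes u :: "real \<Rightarrow> real"
  assumes u: "mono_on {c..e} u" and x: "c \<le> x" "x \<le> e"
    and s: "(\<lambda>t. sgn (t - m) * u t) integrable_on {c..e}"
  shows "\<bar>x - m\<bar> * (u e - u c)
         \<le> \<bar>e - m\<bar> * u e - \<bar>c - m\<bar> * u c - integral {c..e} (\<lambda>t. sgn (t - m) * u t)
           + 2 * (e - c) * (u e - u c)"
proof -
  have "c \<le> e" using x by simp
  have le: "u c \<le> u e" using u x by (auto intro: mono_onD)
  let ?h = "\<lambda>t. sgn (t - m) * u t - sgn (t - m) * u c"
  have hi: "(?h has_integral
      integral {c..e} (\<lambda>t. sgn (t - m) * u t) - (\<bar>e - m\<bar> - \<bar>c - m\<bar>) * u c) {c..e}"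
    by (intro has_integral_diff has_integral_mult_left has_integral_sgn \<open>c \<le> e\<close>
        integrable_integral s)
  have "integral {c..e} (\<lambda>t. sgn (t - m) * u t) - (\<bar>e - m\<bar> - \<bar>c - m\<bar>) * u c
        \<le> (e - c) * (u e - u c)"
  proof (rule has_integral_le[OF hi])
    show "((\<lambda>_. u e - u c) has_integral (e - c) * (u e - u c)) {c..e}"
      using has_integral_const_real[of "u e - u c" c e] \<open>c \<le> e\<close> by simp
    fix t assume t: "t \<in> {c..e}"
    then have "u c \<le> u t" "u t \<le> u e" using u by (auto intro: mono_onD)
    then show "?h t \<le> u e - u c" by (auto simp: sgn_real_def)
  qed
  moreover have "\<bar>x - m\<bar> * (u e - u c) \<le> (\<bar>e - m\<bar> + (e - c)) * (u e - u c)"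
    using le x by (intro mult_right_mono) linarith+
  ultimately show ?thesis by (simp add: algebra_simps)
qed

lemma rs_sum_dist_midpoint_le:
  fixes u :: "real \<Rightarrow> real"
  assumes "a < b" and u: "mono_on {a..b} u" and p: "p tagged_division_of {a..b}"
    and mesh: "\<forall>(x, K)\<in>p. Sup K - Inf K < \<delta>"
  shows "(\<Sum>(x, K)\<in>p. \<bar>x - (a + b)/2\<bar> * (u (Sup K) - u (Inf K)))
         \<le> (b - a) * ((u b - u a)/2 - Q_functional u a b) + 2 * \<delta> * (u b - u a)"
proof -
  define m where "m = (a + b)/2"
  define s where "s = (\<lambda>t. sgn (t - m) * u t)"
  define h where "h = (\<lambda>x. \<bar>x - m\<bar> * u x - integral {a..x} s + 2 * \<delta> * u x)"
  have m: "m \<in> {a..b}" using \<open>a < b\<close> by (simp add: m_def)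
  have si: "s integrable_on {a..b}" unfolding s_def by (rule integrable_sgn_mult[OF u m])
  have "(\<Sum>(x, K)\<in>p. \<bar>x - m\<bar> * (u (Sup K) - u (Inf K))) \<le> (\<Sum>(x, K)\<in>p. h (Sup K) - h (Inf K))"
  proof (rule sum_mono, clarify)
    fix x K assume xK: "(x, K) \<in> p"
    obtain c e where ce: "K = {c..e}" "c \<le> x" "x \<le> e" "a \<le> c" "e \<le> b"
      by (rule tagged_division_of_realE[OF p xK])
    have sub: "{c..e} \<subseteq> {a..b}" using ce by auto
    have "s integrable_on {a..e}" "s integrable_on {c..e}"
      using si ce by (auto elim!: integrable_on_subinterval)
    then have "integral {a..c} s + integral {c..e} s = integral {a..e} s"
      using ce by (intro Henstock_Kurzweil_Integration.integral_combine) auto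
    moreover have "\<bar>x - m\<bar> * (u e - u c) \<le>
        \<bar>e - m\<bar> * u e - \<bar>c - m\<bar> * u c - integral {c..e} s + 2 * (e - c) * (u e - u c)"
      unfolding s_def
      using dist_increment_by_parts[OF mono_on_subset[OF u sub] ce(2,3)]
        \<open>s integrable_on {c..e}\<close> by (simp add: s_def)
    moreover have "2 * (e - c) * (u e - u c) \<le> 2 * \<delta> * (u e - u c)"
    proof (rule mult_right_mono)
      show "2 * (e - c) \<le> 2 * \<delta>" using mesh xK ce by fastforce
      show "0 \<le> u e - u c" using u ce by (auto intro: mono_onD)
    qed
    ultimately have "\<bar>x - m\<bar> * (u e - u c) \<le> h e - h c"
      unfolding h_def by (simp add: algebra_simps)
    then show "\<bar>x - m\<bar> * (u (Sup K) - u (Inf K)) \<le> h (Sup K) - h (Inf K)" using ce by simp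
  qed
  also have "\<dots> = h b - h a" using additive_tagged_division_1[OF _ p] \<open>a < b\<close> by simp
  also have "\<dots> = (b - a) * ((u b - u a)/2 - Q_functional u a b) + 2 * \<delta> * (u b - u a)"
  proof -
    have "(b - a) * Q_functional u a b = integral {a..b} s"
      using \<open>a < b\<close> by (simp add: Q_functional_def s_def m_def)
    moreover have ends: "\<bar>b - m\<bar> = (b - a)/2" "\<bar>a - m\<bar> = (b - a)/2"
      using \<open>a < b\<close> by (auto simp: m_def abs_if field_simps)
    have "h b - h a = (b - a) * ((u b - u a)/2) - integral {a..b} s + 2 * \<delta> * (u b - u a)"
      unfolding h_def ends by (simp add: field_simps)
    ultimately show ?thesis by (simp add: right_diff_distrib)
  qed
  finally show ?thesis unfolding m_def .
qed

lemma has_rs_integralE: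
  assumes "has_rs_integral f u a b I" "\<epsilon> > 0"
  obtains \<delta> where "\<delta> > 0"
    "\<And>p. p tagged_division_of {a..b} \<Longrightarrow> (\<forall>(x, K)\<in>p. Sup K - Inf K < \<delta>) \<Longrightarrow>
      \<bar>(\<Sum>(x, K)\<in>p. f x * (u (Sup K) - u (Inf K))) - I\<bar> < \<epsilon>"
proof -
  from assms(1)[unfolded has_rs_integral_def, THEN spec, THEN mp, OF assms(2)]
  obtain \<delta> where "\<delta> > 0"
    "\<forall>p. p tagged_division_of {a..b} \<and> (\<forall>(x, K)\<in>p. Sup K - Inf K < \<delta>) \<longrightarrow>
      \<bar>(\<Sum>(x, K)\<in>p. f x * (u (Sup K) - u (Inf K))) - I\<bar> < \<epsilon>"
    by (elim exE conjE) (erule (1) that)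
  then show ?thesis by (intro that[of \<delta>]) simp_all
qed

lemma has_rs_integral_unique:
  assumes I: "has_rs_integral f u a b I" and J: "has_rs_integral f u a b J"
  shows "I = J"
proof (rule ccontr)
  let ?S = "\<lambda>p. \<Sum>(x, K)\<in>p. f x * (u (Sup K) - u (Inf K))"
  assume "I \<noteq> J"
  then have pos: "\<bar>I - J\<bar>/2 > 0" by simp
  obtain \<delta>1 where \<delta>1: "\<delta>1 > 0"
    "\<And>p. p tagged_division_of {a..b} \<Longrightarrow> (\<forall>(x, K)\<in>p. Sup K - Inf K < \<delta>1) \<Longrightarrow>
      \<bar>?S p - I\<bar> < \<bar>I - J\<bar>/2"
    by (rule has_rs_integralE[OF I pos]) (erule that, assumption)
  obtain \<delta>2 where \<delta>2: "\<delta>2 > 0"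
    "\<And>p. p tagged_division_of {a..b} \<Longrightarrow> (\<forall>(x, K)\<in>p. Sup K - Inf K < \<delta>2) \<Longrightarrow>
      \<bar>?S p - J\<bar> < \<bar>I - J\<bar>/2"
    by (rule has_rs_integralE[OF J pos]) (erule that, assumption)
  have "min \<delta>1 \<delta>2 > 0" using \<delta>1(1) \<delta>2(1) by simp
  then obtain p where p: "p tagged_division_of {a..b}"
    and mesh: "\<forall>(x, K)\<in>p. Sup K - Inf K < min \<delta>1 \<delta>2"
    by (rule tagged_division_mesh_exists)
  have "\<bar>?S p - I\<bar> < \<bar>I - J\<bar>/2" by (rule \<delta>1(2)[OF p]) (use mesh in auto)
  moreover have "\<bar>?S p - J\<bar> < \<bar>I - J\<bar>/2" by (rule \<delta>2(2)[OF p]) (use mesh in auto)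
  moreover have "\<bar>I - J\<bar> \<le> \<bar>?S p - I\<bar> + \<bar>?S p - J\<bar>"
    using abs_triangle_ineq4[of "?S p - J" "?S p - I"] by simp
  ultimately show False by simp
qed

lemma rs_integral_unique:
  "has_rs_integral f u a b I \<Longrightarrow> rs_integral f u a b = I"
  unfolding rs_integral_def by (rule the_equality) (auto intro: has_rs_integral_unique)

section \<open>The inequality and its sharpness\<close>

lemma abs_D_functional_le:
  assumes "a < b" and u: "mono_on {a..b} u" and bv: "has_bounded_variation f a b"
    and "rs_integrable f u a b"
  shows "\<bar>D_functional f u a b\<bar> \<le> (u b - u a - Q_functional u a b) * total_variation f a b"
proof -
  obtain I where I: "has_rs_integral f u a b I"
    using assms by (auto simp: rs_integrable_def)
  define M where "M = 1 / (b - a) * integral {a..b} f"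
  define V where "V = total_variation f a b"
  define \<Delta> where "\<Delta> = u b - u a"
  define Q where "Q = Q_functional u a b"
  have D: "D_functional f u a b = I - M * \<Delta>"
    using rs_integral_unique[OF I] by (simp add: D_functional_def M_def \<Delta>_def)
  have V0: "0 \<le> V" unfolding V_def using total_variation_nonneg[OF _ bv] \<open>a < b\<close> by simp
  have \<Delta>0: "0 \<le> \<Delta>" unfolding \<Delta>_def using u \<open>a < b\<close> by (auto intro: mono_onD)
  define C where "C = 1 + 2 * V * \<Delta> / (b - a)"
  have C: "C > 0" unfolding C_def using V0 \<Delta>0 \<open>a < b\<close> by (simp add: add_pos_nonneg)
  have est: "\<bar>I - M * \<Delta>\<bar> \<le> (\<Delta> - Q) * V + \<eta> * C" if "\<eta> > 0" for \<eta>
  proof -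
    obtain \<delta> where "\<delta> > 0"
      and \<delta>: "\<And>p. p tagged_division_of {a..b} \<Longrightarrow> (\<forall>(x, K)\<in>p. Sup K - Inf K < \<delta>) \<Longrightarrow>
        \<bar>(\<Sum>(x, K)\<in>p. f x * (u (Sup K) - u (Inf K))) - I\<bar> < \<eta>"
      by (rule has_rs_integralE[OF I \<open>\<eta> > 0\<close>]) (erule that, assumption)
    have "min \<delta> \<eta> > 0" using \<open>\<delta> > 0\<close> \<open>\<eta> > 0\<close> by simp
    then obtain p where p: "p tagged_division_of {a..b}"
      and mesh: "\<forall>(x, K)\<in>p. Sup K - Inf K < min \<delta> \<eta>"
      by (rule tagged_division_mesh_exists)
    let ?du = "\<lambda>K. u (Sup K) - u (Inf K)"
    let ?S = "\<Sum>(x, K)\<in>p. f x * ?du K"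
    have tele: "(\<Sum>(x, K)\<in>p. ?du K) = \<Delta>"
      using additive_tagged_division_1[OF _ p] \<open>a < b\<close> by (simp add: \<Delta>_def)
    have S: "?S - M * \<Delta> = (\<Sum>(x, K)\<in>p. (f x - M) * ?du K)"
      unfolding tele[symmetric] sum_distrib_left sum_subtractf[symmetric]
      by (rule sum.cong) (auto simp: algebra_simps)
    have "\<bar>?S - M * \<Delta>\<bar> \<le> (\<Sum>(x, K)\<in>p. V / 2 * ?du K + V / (b - a) * (\<bar>x - (a + b)/2\<bar> * ?du K))"
      unfolding S
    proof (rule order_trans[OF sum_abs], rule sum_mono, clarify)
      fix x K assume xK: "(x, K) \<in> p"
      obtain c e where ce: "K = {c..e}" "c \<le> x" "x \<le> e" "a \<le> c" "e \<le> b"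
        by (rule tagged_division_of_realE[OF p xK])
      have du: "0 \<le> ?du K" using u ce by (auto intro: mono_onD)
      have "\<bar>f x - M\<bar> \<le> (1/2 + \<bar>x - (a + b)/2\<bar> / (b - a)) * V"
        unfolding M_def V_def using ce by (intro ostrowski_bounded_variation[OF \<open>a < b\<close> _ bv]) auto
      then have "\<bar>f x - M\<bar> * ?du K \<le> (1/2 + \<bar>x - (a + b)/2\<bar> / (b - a)) * V * ?du K"
        using du by (rule mult_right_mono)
      then show "\<bar>(f x - M) * ?du K\<bar> \<le> V / 2 * ?du K + V / (b - a) * (\<bar>x - (a + b)/2\<bar> * ?du K)"
        unfolding abs_mult abs_of_nonneg[OF du] by (simp add: distrib_left distrib_right mult_ac)
    qed
    also have "\<dots> = V / 2 * (\<Sum>(x, K)\<in>p. ?du K)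
        + V / (b - a) * (\<Sum>(x, K)\<in>p. \<bar>x - (a + b)/2\<bar> * ?du K)"
      unfolding sum_distrib_left sum.distrib[symmetric] by (rule sum.cong) auto
    also have "\<dots> \<le> V / 2 * \<Delta> + V / (b - a) * ((b - a) * (\<Delta>/2 - Q) + 2 * \<eta> * \<Delta>)"
    proof -
      have "\<forall>(x, K)\<in>p. Sup K - Inf K < \<eta>" using mesh by auto
      from rs_sum_dist_midpoint_le[OF \<open>a < b\<close> u p this] show ?thesis
        unfolding tele Q_def \<Delta>_def using V0 \<open>a < b\<close>
        by (intro add_left_mono mult_left_mono) auto
    qed
    also have "\<dots> = (\<Delta> - Q) * V + \<eta> * (2 * V * \<Delta> / (b - a))"
      using \<open>a < b\<close> by (simp add: field_simps)
    finally have "\<bar>?S - M * \<Delta>\<bar> \<le> (\<Delta> - Q) * V + \<eta> * (2 * V * \<Delta> / (b - a))" .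
    moreover have "\<bar>?S - I\<bar> < \<eta>" by (rule \<delta>[OF p]) (use mesh in auto)
    ultimately show ?thesis unfolding C_def by (simp add: distrib_left)
  qed
  have "\<bar>I - M * \<Delta>\<bar> \<le> (\<Delta> - Q) * V"
  proof (rule field_le_epsilon)
    fix \<epsilon> :: real assume "\<epsilon> > 0"
    then show "\<bar>I - M * \<Delta>\<bar> \<le> (\<Delta> - Q) * V + \<epsilon>" using est[of "\<epsilon> / C"] C by simp
  qed
  then show ?thesis by (simp add: D \<Delta>_def Q_def V_def)
qed

lemma variation_mono_on:
  assumes "a \<le> b" and f: "mono_on {a..b} f"
  shows "has_bounded_variation f a b" and "total_variation f a b = f b - f a"
proof -
  have eq: "(\<Sum>K\<in>d. \<bar>f (Sup K) - f (Inf K)\<bar>) = f b - f a" if d: "d division_of {a..b}" for d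
  proof -
    have "\<bar>f (Sup K) - f (Inf K)\<bar> = f (Sup K) - f (Inf K)" if K: "K \<in> d" for K
    proof -
      obtain c e where "K = {c..e}" "c \<le> e" "a \<le> c" "e \<le> b"
        by (rule division_of_realE[OF d K])
      then show ?thesis using mono_onD[OF f, of c e] by simp
    qed
    then show ?thesis using telescope_division[OF \<open>a \<le> b\<close> d, of f] by simp
  qed
  have triv: "{{a..b}} division_of {a..b}" using division_of_self[of a b] \<open>a \<le> b\<close> by simp
  have "{\<Sum>K\<in>d. \<bar>f (Sup K) - f (Inf K)\<bar> | d. d division_of {a..b}} = {f b - f a}" (is "?A = _")
  proof (intro equalityI subsetI)
    fix y assume "y \<in> ?A"
    then show "y \<in> {f b - f a}" using eq by auto
  next
    fix y assume "y \<in> {f b - f a}"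
    then have "y = (\<Sum>K\<in>{{a..b}}. \<bar>f (Sup K) - f (Inf K)\<bar>)" using eq[OF triv] by simp
    then show "y \<in> ?A" using triv by (intro CollectI exI conjI)
  qed
  then show "has_bounded_variation f a b" "total_variation f a b = f b - f a"
    unfolding has_bounded_variation_def total_variation_def by simp_all
qed

text \<open>
  Only the interval that ends at \<open>b\<close> sees the jump of the integrator, and once the mesh is below
  \<open>b - t\<close> its tag lies beyond \<open>t\<close>, where the integrand equals 1. Hence every such sum is exactly 1.
\<close>

lemma has_rs_integral_two_jumps:
  fixes a b t :: real
  assumes "a < b" "t < b"
  shows "has_rs_integral (\<lambda>x. if t \<le> x then 1 else 0) (\<lambda>x. if x = b then 1 else 0) a b 1"
  unfolding has_rs_integral_def
proof (intro allI impI)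
  let ?f = "\<lambda>x. if t \<le> x then 1 else 0 :: real" and ?u = "\<lambda>x. if x = b then 1 else 0 :: real"
  fix \<epsilon> :: real assume "\<epsilon> > 0"
  have "(\<Sum>(x, K)\<in>p. ?f x * (?u (Sup K) - ?u (Inf K))) = 1"
    if p: "p tagged_division_of {a..b}" and mesh: "\<forall>(x, K)\<in>p. Sup K - Inf K < b - t" for p
  proof -
    have "(\<Sum>(x, K)\<in>p. ?f x * (?u (Sup K) - ?u (Inf K))) = (\<Sum>(x, K)\<in>p. ?u (Sup K) - ?u (Inf K))"
    proof (rule sum.cong[OF refl], clarify)
      fix x K assume xK: "(x, K) \<in> p"
      obtain c e where ce: "K = {c..e}" "c \<le> x" "x \<le> e" "a \<le> c" "e \<le> b"
        by (rule tagged_division_of_realE[OF p xK])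
      have "e - c < b - t" using mesh xK ce by fastforce
      then show "?f x * (?u (Sup K) - ?u (Inf K)) = ?u (Sup K) - ?u (Inf K)" using ce by auto
    qed
    also have "\<dots> = 1"
      using additive_tagged_division_1[of a b p ?u] p \<open>a < b\<close> by simp
    finally show ?thesis .
  qed
  then show "\<exists>\<delta>>0. \<forall>p. p tagged_division_of {a..b} \<and> (\<forall>(x, K)\<in>p. Sup K - Inf K < \<delta>) \<longrightarrow>
      \<bar>(\<Sum>(x, K)\<in>p. ?f x * (?u (Sup K) - ?u (Inf K))) - 1\<bar> < \<epsilon>"
    using \<open>t < b\<close> \<open>\<epsilon> > 0\<close> by (intro exI[of _ "b - t"]) auto
qed

lemma constant_one_best_possible:
  fixes a b c :: real
  assumes "a < b" "c < 1"
  shows "\<exists>u f. mono_on {a..b} u \<and> has_bounded_variation f a b \<and> rs_integrable f u a b \<and>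
           c * (u b - u a - Q_functional u a b) * total_variation f a b < \<bar>D_functional f u a b\<bar>"
proof -
  \<comment> \<open>The mean of the step function is then \<open>(1 - max c 0) / 2\<close>, which is less than \<open>1 - c\<close>; the
      maximum with 0 keeps the jump inside the interval when \<open>c\<close> is negative.\<close>
  define t where "t = b - (b - a) * ((1 - max c 0)/2)"
  let ?f = "\<lambda>x. if t \<le> x then 1 else 0 :: real" and ?u = "\<lambda>x. if x = b then 1 else 0 :: real"
  have "0 < (b - a) * ((1 - max c 0)/2)" using assms by simp
  then have "t < b" by (simp add: t_def)
  have "(b - a) * ((1 - max c 0)/2) < (b - a) * 1"
    using assms by (intro mult_strict_left_mono) auto
  then have "a < t" by (simp add: t_def)
  have u: "mono_on {a..b} ?u" by (auto intro!: mono_onI)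
  have f: "mono_on {a..b} ?f" by (auto intro!: mono_onI)
  note rs = has_rs_integral_two_jumps[OF \<open>a < b\<close> \<open>t < b\<close>]
  have "integral {a..b} (\<lambda>x. sgn (x - (a + b)/2) * ?u x) = 0"
    by (rule integral_unique, rule has_integral_spike_finite[of "{b}", OF _ _ has_integral_0]) auto
  then have Q: "Q_functional ?u a b = 0" by (simp only: Q_functional_def mult_zero_right)
  have "(?f has_integral (b - t)) {a..b}"
  proof -
    have "((\<lambda>_. 1::real) has_integral (b - t)) {t..b}"
      using has_integral_const_real[of "1::real" t b] \<open>t < b\<close> by simp
    then have "((\<lambda>x. if x \<in> {t..b} then 1::real else 0) has_integral (b - t)) {a..b}"
      using \<open>a < t\<close> by (subst has_integral_restrict) auto
    then show ?thesis by (rule has_integral_eq[rotated]) auto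
  qed
  then have "integral {a..b} ?f = b - t" by (rule integral_unique)
  then have "D_functional ?f ?u a b = 1 - (1 - max c 0)/2"
    unfolding D_functional_def rs_integral_unique[OF rs]
    using \<open>a < b\<close> by (simp add: t_def)
  moreover have "c < 1 - (1 - max c 0)/2" "0 < 1 - (1 - max c 0)/2"
    using \<open>c < 1\<close> by (auto simp: max_def field_simps)
  ultimately have "c < \<bar>D_functional ?f ?u a b\<bar>" by simp
  moreover have "total_variation ?f a b = 1"
    using variation_mono_on(2)[OF _ f] \<open>a < t\<close> \<open>t < b\<close> by simp
  ultimately have "c * (?u b - ?u a - Q_functional ?u a b) * total_variation ?f a b
      < \<bar>D_functional ?f ?u a b\<bar>"
    using Q \<open>a < b\<close> by simp
  moreover have "has_bounded_variation ?f a b" using variation_mono_on(1)[OF _ f] \<open>a < b\<close> by simp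
  moreover have "rs_integrable ?f ?u a b" using rs by (auto simp: rs_integrable_def)
  ultimately show ?thesis using u by blast
qed

theorem theorem14:
  fixes a b :: real
  assumes "a < b"
  shows "(\<forall>u f :: real \<Rightarrow> real.
            mono_on {a..b} u \<and> has_bounded_variation f a b \<and> rs_integrable f u a b \<longrightarrow>
              \<bar>D_functional f u a b\<bar> \<le> (u b - u a - Q_functional u a b) * total_variation f a b
            \<and> (u b - u a - Q_functional u a b) * total_variation f a b
                \<le> (u b - u a) * total_variation f a b
            \<and> Q_functional u a b =
                1 / (b - a) *
                  integral {a..b} (\<lambda>x. sgn (x - (a + b) / 2) * (u x - u ((a + b) / 2)))
            \<and> Q_functional u a b \<ge> 0)
       \<and> (\<forall>c<1. \<not> (\<forall>u f :: real \<Rightarrow> real.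
            mono_on {a..b} u \<and> has_bounded_variation f a b \<and> rs_integrable f u a b \<longrightarrow>
              \<bar>D_functional f u a b\<bar>
                \<le> c * (u b - u a - Q_functional u a b) * total_variation f a b))"
proof (intro conjI allI impI; (elim conjE)?)
  fix u f :: "real \<Rightarrow> real"
  assume u: "mono_on {a..b} u" and bv: "has_bounded_variation f a b"
    and rs: "rs_integrable f u a b"
  show "\<bar>D_functional f u a b\<bar> \<le> (u b - u a - Q_functional u a b) * total_variation f a b"
    by (rule abs_D_functional_le[OF assms u bv rs])
  show "Q_functional u a b = 1 / (b - a) *
      integral {a..b} (\<lambda>x. sgn (x - (a + b) / 2) * (u x - u ((a + b) / 2)))"
    by (rule Q_functional_eq[OF assms u])
  show "0 \<le> Q_functional u a b" by (rule Q_functional_nonneg[OF assms u])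
  then show "(u b - u a - Q_functional u a b) * total_variation f a b
      \<le> (u b - u a) * total_variation f a b"
    using total_variation_nonneg[OF _ bv] assms by (intro mult_right_mono) auto
next
  fix c :: real
  assume "c < 1"
  from constant_one_best_possible[OF assms this]
  show "\<not> (\<forall>u f :: real \<Rightarrow> real.
            mono_on {a..b} u \<and> has_bounded_variation f a b \<and> rs_integrable f u a b \<longrightarrow>
              \<bar>D_functional f u a b\<bar>
                \<le> c * (u b - u a - Q_functional u a b) * total_variation f a b)"
    by (meson not_less)
qed

end
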